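(* Let $\pi=\omega\oplus\tau$ be a plus-decomposable DI-sortable permutation (with $\omega,\tau$ nonempty). Then the Schröder path corresponding to $\pi$ is the Schröder path corresponding to $\omega$, followed by a single diagonal step $\mathsf{D}$ (lying on the main diagonal $y=x$), followed by the Schröder path corresponding to $\tau$ (translated to start at the endpoint of that diagonal step). Furthermore, the Schröder paths having a diagonal step on the main diagonal correspond, under this correspondence, exactly to the plus-decomposable DI-sortable permutations.
   Context: A permutation $\pi=\pi_1\cdots\pi_n$ of $[n]$ is processed by a machine consisting of an input (initially $\pi_1,\dots,\pi_n$), a first stack, a second stack, and an output, with operations: $\mathsf{E}$ moves the next input entry onto the top of the first stack; $\mathsf{N}$ pops the top of the first stack and pushes it onto the second stack; $\mathsf{C}$ pops the top of the second stack to the output. A DI word of $\pi$ is a word over $\{\mathsf{E},\mathsf{N},\mathsf{C}\}$ whose operations are all legal when applied in order starting from $\pi$ in the input and empty stacks, whose final output is $12\cdots n$, and during which the first stack's entries always decrease from top to bottom and the second stack's entries always increase from top to bottom; $\pi$ is DI-sortable if it has a DI word. The DI-sortable permutations are closed under taking patterns, so if $\omega\oplus\tau$ is DI-sortable then so are $\omega$ and $\tau$. The ADI word of a DI-sortable $\pi$ is the word of operations performed by the following algorithm, which at each stage performs the first applicable step: (1) if the top entry of the second stack is the smallest value not yet output, perform $\mathsf{C}$; (2) if the first stack is nonempty and its $m$ entries are exactly the next $m$ values to be output, transfer all of them to the second stack by $m$ successive $\mathsf{N}$ operations; (3) otherwise, if the next input entry is smaller than the top of the second stack and larger than the top of the first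 stack (each comparison counting as satisfied if the corresponding stack is empty), perform $\mathsf{E}$; (4) otherwise perform $\mathsf{N}$. In an ADI word, every maximal block of consecutive $\mathsf{C}$'s is immediately preceded by $\mathsf{E}\mathsf{N}$. The map $\Phi$: given an ADI word $W$ with $k$ maximal blocks of consecutive $\mathsf{C}$'s of lengths $\tau_1,\dots,\tau_k$ (in order), set $\ell_i=\tau_1+\cdots+\tau_i$. Form $T$ by replacing each substring $\mathsf{E}\mathsf{N}\mathsf{C}^{\tau_i}$ (a maximal block of $\mathsf{C}$'s with the two letters preceding it) by a single $\mathsf{N}$. Form $S_{\mathsf{D}}$ from $T$ by replacing, for each $i\in[k]$, the $\ell_i$-th $\mathsf{N}$ of $T$ by $\mathsf{D}$; delete the final letter (a $\mathsf{D}$) of $S_{\mathsf{D}}$ to obtain $\Phi(W)$. The Schröder path corresponding to a DI-sortable permutation $\pi$ of $[n]$ is $\Phi(W)$ for its ADI word $W$; it is a lattice path (steps $\mathsf{E}=(1,0)$, $\mathsf{N}=(0,1)$, $\mathsf{D}=(1,1)$) from $(0,0)$ to $(n-1,n-1)$ weakly below $y=x$, and for $n=1$ it is the empty path. A permutation $\pi$ is plus-decomposable if $\pi$ is the concatenation of two nonempty consecutive segments $\omega$ and $\tau'$ with every value in $\omega$ smaller than every value in $\tau'$; then $\pi=\omega\oplus\tau$, where $\tau$ is obtained from $\tau'$ by subtracting $|\omega|$ from each entry. Otherwise $\pi$ is plus-indecomposable. *)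

theory Defs
  imports "HOL-Combinatorics.Multiset_Permutations"
begin

text \<open>Permutations of \<open>[n]\<close> are represented in one-line notation, as lists
  \<open>\<pi> \<in> permutations_of_set {1..n}\<close>.\<close>

definition is_perm :: "nat list \<Rightarrow> bool" where
  "is_perm \<pi> \<longleftrightarrow> \<pi> \<in> permutations_of_set {1..length \<pi>}"

definition plus_sum :: "nat list \<Rightarrow> nat list \<Rightarrow> nat list" (infixr "\<oplus>\<^sub>p" 65) where
  "\<omega> \<oplus>\<^sub>p \<tau> = \<omega> @ map (\<lambda>x. x + length \<omega>) \<tau>"

definition plus_decomposable :: "nat list \<Rightarrow> bool" where
  "plus_decomposable \<pi> \<longleftrightarrow>
     (\<exists>\<omega> \<tau>'. \<omega> \<noteq> [] \<and> \<tau>' \<noteq> [] \<and> \<pi> = \<omega> @ \<tau>' \<and> (\<forall>a\<in>set \<omega>. \<forall>b\<in>set \<tau>'. a < b))"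


section \<open>The machine\<close>

datatype letter = E | N | C

text \<open>A state consists of the remaining input, the first stack, the second stack (both listed
  from top to bottom) and the output (listed in the order in which the entries were output).\<close>

type_synonym state = "nat list \<times> nat list \<times> nat list \<times> nat list"

fun apply_op :: "letter \<Rightarrow> state \<Rightarrow> state option" where
  "apply_op E (x # inp, s, t, out) = Some (inp, x # s, t, out)"
| "apply_op N (inp, x # s, t, out) = Some (inp, s, x # t, out)"
| "apply_op C (inp, s, x # t, out) = Some (inp, s, t, out @ [x])"
| "apply_op _ _ = None"

fun run :: "letter list \<Rightarrow> state \<Rightarrow> state option" where
  "run [] \<sigma> = Some \<sigma>"
| "run (a # w) \<sigma> = Option.bind (apply_op a \<sigma>) (run w)"

definition initial :: "nat list \<Rightarrow> state" where
  "initial \<pi> = (\<pi>, [], [], [])"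

fun stacks_DI :: "state \<Rightarrow> bool" where
  "stacks_DI (inp, s, t, out) \<longleftrightarrow> sorted_wrt (>) s \<and> sorted_wrt (<) t"

definition DI_word :: "nat list \<Rightarrow> letter list \<Rightarrow> bool" where
  "DI_word \<pi> w \<longleftrightarrow>
     run w (initial \<pi>) = Some ([], [], [], [1..<Suc (length \<pi>)]) \<and>
     (\<forall>k\<le>length w. \<forall>\<sigma>. run (take k w) (initial \<pi>) = Some \<sigma> \<longrightarrow> stacks_DI \<sigma>)"

definition DI_sortable :: "nat list \<Rightarrow> bool" where
  "DI_sortable \<pi> \<longleftrightarrow> (\<exists>w. DI_word \<pi> w)"


section \<open>The ADI word\<close>

text \<open>On a permutation of \<open>[n]\<close>, the algorithm only ever outputs the smallest value not yet
  output, so that value is \<open>Suc (length out)\<close>, and the next \<open>m\<close> values to be output are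
  \<open>Suc (length out), \<dots>, length out + m\<close>. The algorithm stops when \<^term>\<open>N\<close> in the last step
  would be illegal; for a DI-sortable permutation this happens only once all entries have
  been output.\<close>

function ADI_from :: "state \<Rightarrow> letter list" where
  "ADI_from (inp, s, t, out) =
     (if t \<noteq> [] \<and> hd t = Suc (length out) then
        C # ADI_from (inp, s, tl t, out @ [hd t])
      else if s \<noteq> [] \<and> set s = {Suc (length out)..length out + length s} then
        replicate (length s) N @ ADI_from (inp, [], rev s @ t, out)
      else if inp \<noteq> [] \<and> (t = [] \<or> hd inp < hd t) \<and> (s = [] \<or> hd s < hd inp) then
        E # ADI_from (tl inp, hd inp # s, t, out)
      else if s \<noteq> [] then
        N # ADI_from (inp, tl s, hd s # t, out)
      else [])"
  by pat_completeness auto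
termination
  by (relation "measure (\<lambda>(inp, s, t, out). 3 * length inp + 2 * length s + length t)")
     (auto simp: neq_Nil_conv)

declare ADI_from.simps [simp del]

definition ADI_word :: "nat list \<Rightarrow> letter list" where
  "ADI_word \<pi> = ADI_from (initial \<pi>)"


section \<open>Lattice paths\<close>

datatype step = East | North | Diag

definition path_x :: "step list \<Rightarrow> nat" where
  "path_x p = count_list p East + count_list p Diag"

definition path_y :: "step list \<Rightarrow> nat" where
  "path_y p = count_list p North + count_list p Diag"

definition is_schroder_path :: "nat \<Rightarrow> step list \<Rightarrow> bool" where
  "is_schroder_path m p \<longleftrightarrow>
     path_x p = m \<and> path_y p = m \<and> (\<forall>k\<le>length p. path_y (take k p) \<le> path_x (take k p))"

definition has_main_diagonal_step :: "step list \<Rightarrow> bool" where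
  "has_main_diagonal_step p \<longleftrightarrow> (\<exists>q r. p = q @ Diag # r \<and> path_x q = path_y q)"


section \<open>The map \<open>\<Phi>\<close>\<close>

lemma length_dropWhile_le_Suc [termination_simp]: "length (dropWhile P xs) < Suc (length xs)"
  by (simp add: le_imp_less_Suc length_dropWhile_le)

lemma length_dropWhile_le_Suc3 [termination_simp]:
  "length (dropWhile P xs) < Suc (Suc (Suc (length xs)))"
  using length_dropWhile_le[of P xs] by linarith

fun C_blocks :: "letter list \<Rightarrow> nat list" where
  "C_blocks [] = []"
| "C_blocks (C # w) =
     Suc (length (takeWhile (\<lambda>a. a = C) w)) # C_blocks (dropWhile (\<lambda>a. a = C) w)"
| "C_blocks (_ # w) = C_blocks w"

text \<open>Replaces every \<open>EN\<close> followed by a maximal block of \<open>C\<close>'s, together with that block, by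
  a single \<^term>\<open>N\<close>; this gives the word \<open>T\<close> in the construction of \<open>\<Phi>\<close>.\<close>

fun collapse :: "letter list \<Rightarrow> letter list" where
  "collapse (E # N # C # w) = N # collapse (dropWhile (\<lambda>a. a = C) w)"
| "collapse (a # w) = a # collapse w"
| "collapse [] = []"

text \<open>\<open>mark L j T\<close> replaces every \<^term>\<open>N\<close> of \<open>T\<close> whose position among the \<open>N\<close>'s, counted
  from \<open>j + 1\<close>, lies in \<open>L\<close> by a diagonal step. The case \<^term>\<open>C\<close> does not arise from ADI words,
  where every block of \<open>C\<close>'s is preceded by \<open>EN\<close>.\<close>

fun mark :: "nat set \<Rightarrow> nat \<Rightarrow> letter list \<Rightarrow> step list" where
  "mark L j [] = []"
| "mark L j (E # w) = East # mark L j w"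
| "mark L j (N # w) = (if Suc j \<in> L then Diag else North) # mark L (Suc j) w"
| "mark L j (C # w) = mark L j w"

definition \<Phi> :: "letter list \<Rightarrow> step list" where
  "\<Phi> W = (let bs = C_blocks W; L = {sum_list (take i bs) | i. i \<in> {1..length bs}}
          in butlast (mark L 0 (collapse W)))"

definition schroder_path_of :: "nat list \<Rightarrow> step list" where
  "schroder_path_of \<pi> = \<Phi> (ADI_word \<pi>)"

end

theory Submission
  imports Defs
begin

text \<open>
  The algorithm only outputs entries when the first stack is empty, so an ADI word is a sequence
  of balanced \<open>E\<close>/\<open>N\<close> words separated by blocks \<open>E N C\<^sup>k\<close>. Conversely, every such word that never
  outputs from an empty second stack is the ADI word of a unique permutation, obtained by running the
  machine backwards from the sorted output; the monotonicity of both stacks is then automatic. That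
  the algorithm never gets stuck on a sortable permutation is an exchange argument: each of its
  steps preserves the existence of a sorting completion.

  In the path, the final letters of the blocks are recovered as the vertical steps at which the
  word \<open>T\<close> reaches a new minimal height, and the block lengths as the gaps between diagonal steps; the
  path stays below the diagonal iff no block outputs more entries than the second stack contains.
  This makes the correspondence bijective. Concatenation of words corresponds to the direct sum of
  permutations and, on paths, to joining at a diagonal step on the main diagonal. So a path
  having such a step is split there, and injectivity identifies the permutation as a direct sum.
\<close>

section \<open>Sortable states and the exchange argument\<close>

text \<open>Order is checked only when an entry is popped, and the final output need only be sorted,
  not equal to \<open>1, ..., n\<close>. This makes the predicate stable under deleting and
  relabelling entries.\<close>

inductive sortable :: "state \<Rightarrow> bool" where
  finish: "sorted_wrt (<) out \<Longrightarrow> sortable ([], [], [], out)"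
| enter: "sortable (inp, x # s, t, out) \<Longrightarrow> sortable (x # inp, s, t, out)"
| move: "sortable (inp, s, x # t, out) \<Longrightarrow> \<forall>y\<in>set s. y < x \<Longrightarrow> sortable (inp, x # s, t, out)"
| release: "sortable (inp, s, t, out @ [x]) \<Longrightarrow> \<forall>y\<in>set t. x < y \<Longrightarrow> sortable (inp, s, x # t, out)"

lemma sortable_induct [consumes 1, case_names finish enter move release]:
  assumes "sortable (inp, s, t, out)"
    and "\<And>out. sorted_wrt (<) out \<Longrightarrow> P [] [] [] out"
    and "\<And>inp x s t out. sortable (inp, x # s, t, out) \<Longrightarrow> P inp (x # s) t out \<Longrightarrow> P (x # inp) s t out"
    and "\<And>inp x s t out. sortable (inp, s, x # t, out) \<Longrightarrow> \<forall>y\<in>set s. y < x \<Longrightarrow>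
           P inp s (x # t) out \<Longrightarrow> P inp (x # s) t out"
    and "\<And>inp x s t out. sortable (inp, s, t, out @ [x]) \<Longrightarrow> \<forall>y\<in>set t. x < y \<Longrightarrow>
           P inp s t (out @ [x]) \<Longrightarrow> P inp s (x # t) out"
  shows "P inp s t out"
proof -
  have "case \<sigma> of (inp, s, t, out) \<Rightarrow> P inp s t out" if "sortable \<sigma>" for \<sigma>
    using that by (induction rule: sortable.induct) (auto intro: assms(2-))
  from this[OF assms(1)] show ?thesis by simp
qed

text \<open>Every stacked entry is popped eventually, and at that moment it is compared with all
  entries below it.\<close>

lemma sortable_stacks:
  assumes "sortable (inp, s, t, out)"
  shows "sorted_wrt (>) s" "sorted_wrt (<) t"
  using assms by (induction rule: sortable_induct) auto

lemma sortable_out: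
  assumes "sortable (inp, s, t, out)"
  shows "sorted_wrt (<) out \<and> (\<forall>a\<in>set out. \<forall>b\<in>set inp \<union> set s \<union> set t. a < b)"
  using assms by (induction rule: sortable_induct) (auto simp: sorted_wrt_append)

section \<open>Sortable states and DI words\<close>

lemma sortable_imp_DI_run:
  assumes "sortable \<sigma>"
  shows "\<exists>w out. run w \<sigma> = Some ([], [], [], out) \<and> sorted_wrt (<) out \<and>
    (\<forall>k\<le>length w. \<forall>\<rho>. run (take k w) \<sigma> = Some \<rho> \<longrightarrow> stacks_DI \<rho>)"
  using assms
proof (induction rule: sortable.induct)
  case (finish out)
  then show ?case by (intro exI[of _ "[]"] exI[of _ out]) auto
next
  case (enter inp x s t out)
  then obtain w out' where w: "run w (inp, x # s, t, out) = Some ([], [], [], out')"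
    "sorted_wrt (<) out'" 
    "\<forall>k\<le>length w. \<forall>\<rho>. run (take k w) (inp, x # s, t, out) = Some \<rho> \<longrightarrow> stacks_DI \<rho>" by blast
  have "stacks_DI (x # inp, s, t, out)"
    using sortable_stacks[OF sortable.enter[OF enter.hyps]] by simp
  with w show ?case by (intro exI[of _ "E # w"] exI[of _ out']) (auto simp: take_Cons split: nat.splits)
next
  case (move inp s x t out)
  then obtain w out' where w: "run w (inp, s, x # t, out) = Some ([], [], [], out')"
    "sorted_wrt (<) out'" 
    "\<forall>k\<le>length w. \<forall>\<rho>. run (take k w) (inp, s, x # t, out) = Some \<rho> \<longrightarrow> stacks_DI \<rho>" by blast
  have "stacks_DI (inp, x # s, t, out)"
    using sortable_stacks[OF sortable.move[OF move.hyps]] by simp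
  with w show ?case by (intro exI[of _ "N # w"] exI[of _ out']) (auto simp: take_Cons split: nat.splits)
next
  case (release inp s t out x)
  then obtain w out' where w: "run w (inp, s, t, out @ [x]) = Some ([], [], [], out')"
    "sorted_wrt (<) out'" 
    "\<forall>k\<le>length w. \<forall>\<rho>. run (take k w) (inp, s, t, out @ [x]) = Some \<rho> \<longrightarrow> stacks_DI \<rho>" by blast
  have "stacks_DI (inp, s, x # t, out)"
    using sortable_stacks[OF sortable.release[OF release.hyps]] by simp
  with w show ?case by (intro exI[of _ "C # w"] exI[of _ out']) (auto simp: take_Cons split: nat.splits)
qed

lemma DI_run_imp_sortable:
  assumes "run w \<sigma> = Some ([], [], [], out)" "sorted_wrt (<) out"
    "\<forall>k\<le>length w. \<forall>\<rho>. run (take k w) \<sigma> = Some \<rho> \<longrightarrow> stacks_DI \<rho>"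
  shows "sortable \<sigma>"
  using assms
proof (induction w arbitrary: \<sigma>)
  case Nil
  then show ?case by (auto intro: sortable.finish)
next
  case (Cons a w)
  from Cons.prems(1) obtain \<sigma>' where s: "apply_op a \<sigma> = Some \<sigma>'" "run w \<sigma>' = Some ([], [], [], out)"
    by (auto simp: bind_eq_Some_conv)
  have "stacks_DI \<rho>" if "k \<le> length w" "run (take k w) \<sigma>' = Some \<rho>" for k \<rho>
    using that Cons.prems(3)[rule_format, of "Suc k" \<rho>] s(1) by simp
  with Cons s have IH: "sortable \<sigma>'" by blast
  have "stacks_DI \<sigma>" using Cons.prems(3)[rule_format, of 0] by simp
  with s(1) IH show ?case
    by (cases "(a, \<sigma>)" rule: apply_op.cases) (auto intro: sortable.intros)
qed

fun contents :: "state \<Rightarrow> nat multiset" where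
  "contents (inp, s, t, out) = mset inp + mset s + mset t + mset out"

lemma contents_run: "run w \<sigma> = Some \<sigma>' \<Longrightarrow> contents \<sigma>' = contents \<sigma>"
proof (induction w arbitrary: \<sigma>)
  case (Cons a w)
  then obtain \<rho> where r: "apply_op a \<sigma> = Some \<rho>" "run w \<rho> = Some \<sigma>'"
    by (auto simp: bind_eq_Some_conv)
  have "contents \<rho> = contents \<sigma>"
    using r(1) by (cases "(a, \<sigma>)" rule: apply_op.cases) auto
  with Cons.IH[OF r(2)] show ?case by simp
qed simp

lemma is_perm_iff: "is_perm \<pi> \<longleftrightarrow> distinct \<pi> \<and> set \<pi> = {1..length \<pi>}"
  by (auto simp: is_perm_def permutations_of_set_def)

lemma DI_sortable_iff:
  assumes "is_perm \<pi>"
  shows "DI_sortable \<pi> \<longleftrightarrow> sortable (\<pi>, [], [], [])"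
proof
  assume "DI_sortable \<pi>"
  then obtain w where "DI_word \<pi> w" by (auto simp: DI_sortable_def)
  then show "sortable (\<pi>, [], [], [])"
    unfolding DI_word_def initial_def by (intro DI_run_imp_sortable[of w _ "[1..<Suc (length \<pi>)]"]) (auto simp del: upt_Suc)
next
  assume "sortable (\<pi>, [], [], [])"
  from sortable_imp_DI_run[OF this] obtain w out where
    w: "run w (initial \<pi>) = Some ([], [], [], out)" "sorted_wrt (<) out"
      "\<forall>k\<le>length w. \<forall>\<rho>. run (take k w) (initial \<pi>) = Some \<rho> \<longrightarrow> stacks_DI \<rho>"
    by (auto simp: initial_def)
  \<comment> \<open>Operations only move entries around, so the sorted output is the increasing list
    of the values of \<pi>.\<close>
  from contents_run[OF w(1)] have "mset out = mset \<pi>" by (simp add: initial_def)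
  then have "set out = set \<pi>" by (rule mset_eq_setD)
  then have "set out = set [1..<Suc (length \<pi>)]" using assms by (auto simp: is_perm_iff)
  then have "out = [1..<Suc (length \<pi>)]" using w(2)
    by (intro strict_sorted_equal) (auto simp del: upt_Suc)
  with w show "DI_sortable \<pi>" by (auto simp: DI_sortable_def DI_word_def)
qed

section \<open>Closure under patterns and relabelling\<close>

lemma sortable_filter:
  assumes "sortable (inp, s, t, out)"
  shows "sortable (filter P inp, filter P s, filter P t, filter P out)"
  using assms
  by (induction rule: sortable_induct) (auto intro: sortable.intros simp: sorted_wrt_filter)

lemma sortable_map:
  assumes "sortable (inp, s, t, out)"
    "strict_mono_on (set inp \<union> set s \<union> set t \<union> set out) f"
  shows "sortable (map f inp, map f s, map f t, map f out)"
  using assms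
proof (induction rule: sortable_induct)
  case (finish out)
  have "sorted_wrt (\<lambda>x y. f x < f y) out"
    by (rule sorted_wrt_mono_rel[OF _ finish.hyps]) (use finish.prems in \<open>auto simp: strict_mono_on_def\<close>)
  then show ?case by (simp add: sortable.finish sorted_wrt_map)
next
  case (enter inp x s t out)
  then show ?case by (auto intro: sortable.enter)
next
  case (move inp x s t out)
  then show ?case by (auto intro!: sortable.move simp: strict_mono_on_def)
next
  case (release inp x s t out)
  then show ?case by (auto intro!: sortable.release simp: strict_mono_on_def)
qed

text \<open>Values up to \<open>length \<omega>\<close> form the first summand and the larger ones
  the second, so each summand is a pattern; the second is shifted back down.\<close>

lemma sortable_plus_sum:
  assumes "is_perm \<omega>" "is_perm \<tau>" "sortable (\<omega> \<oplus>\<^sub>p \<tau>, [], [], [])"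
  shows "sortable (\<omega>, [], [], [])" "sortable (\<tau>, [], [], [])"
proof -
  let ?n = "length \<omega>"
  have w: "\<forall>x\<in>set \<omega>. x \<le> ?n" and t: "\<forall>x\<in>set \<tau>. 0 < x"
    using assms(1,2) by (auto simp: is_perm_iff)
  have 1: "filter (\<lambda>x. x \<le> ?n) (\<omega> \<oplus>\<^sub>p \<tau>) = \<omega>" 
    using w t by (auto simp: plus_sum_def filter_id_conv filter_empty_conv)
  have 2: "filter (\<lambda>x. ?n < x) (\<omega> \<oplus>\<^sub>p \<tau>) = map (\<lambda>x. x + ?n) \<tau>" 
    using w t by (fastforce simp: plus_sum_def filter_id_conv filter_empty_conv)
  show "sortable (\<omega>, [], [], [])"
    using sortable_filter[OF assms(3), of "\<lambda>x. x \<le> ?n"] 1 by simp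
  have "sortable (map (\<lambda>x. x + ?n) \<tau>, [], [], [])"
    using sortable_filter[OF assms(3), of "\<lambda>x. ?n < x"] 2 by simp
  moreover have "strict_mono_on (set (map (\<lambda>x. x + ?n) \<tau>)) (\<lambda>x. x - ?n)"
    by (auto simp: strict_mono_on_def)
  ultimately show "sortable (\<tau>, [], [], [])"
    using sortable_map[of "map (\<lambda>x. x + ?n) \<tau>" "[]" "[]" "[]" "\<lambda>x. x - ?n"] by (simp add: comp_def)
qed

section \<open>Exchange lemmas\<close>

text \<open>\<open>z\<close> has to leave before \<open>a\<close>, which has to leave before \<open>x\<close>; but \<open>x\<close> blocks \<open>z\<close> on the first
  stack and cannot move onto \<open>a\<close>.\<close>

lemma not_sortable:
  assumes "sortable (inp, s, t, out)" "a \<in> set t" "z < a" "a < x"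
    "x \<in> set s \<and> z \<in> set inp \<or> (\<exists>p q. inp = p @ x # q \<and> z \<in> set q)"
  shows False
  using assms
proof (induction rule: sortable_induct)
  case (enter inp y s t out)
  from sortable_stacks[OF enter.hyps] have *: "\<forall>v\<in>set s. v < y" by simp
  show ?case
  proof (cases "x \<in> set s \<and> z \<in> set (y # inp)")
    case True
    with * enter.prems have "z \<noteq> y" by auto
    with True enter show ?thesis by auto
  next
    case False
    with enter.prems obtain p q where "y # inp = p @ x # q" "z \<in> set q" by blast
    then have "y = x \<and> z \<in> set inp \<or> (\<exists>p q. inp = p @ x # q \<and> z \<in> set q)"
      by (cases p) auto
    with enter show ?thesis by auto
  qed
next
  case (move inp y s t out)
  from sortable_stacks[OF move.hyps(1)] have "\<forall>v\<in>set t. y < v" by simp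
  \<comment> \<open>An entry can be pushed above \<open>a\<close> only if it is smaller than
    \<open>a\<close>.\<close>
  with move.prems have "y \<noteq> x" by auto
  with move show ?case by auto
next
  case (release inp y s t out)
  have "z \<in> set inp" using release.prems by auto
  \<comment> \<open>Since \<open>z\<close> is still to be output, the released \<open>y\<close> is
    smaller than \<open>z\<close> and so is not \<open>a\<close>.\<close>
  with sortable_out[OF release.hyps(1)] have "y < z" by auto
  with release show ?case by auto
qed simp

text \<open>Entering commutes with releasing \<open>x\<close>, and no entry can be moved on top of
  the minimum \<open>x\<close>, so the release can be brought to the front.\<close>

lemma sortable_pop_second:
  assumes "sortable (inp, s, x # t, out)" "\<forall>y\<in>set inp \<union> set s \<union> set t. x < y"
  shows "sortable (inp, s, t, out @ [x])"
proof -
  have "t' = x # t \<Longrightarrow> \<forall>y\<in>set inp \<union> set s \<union> set t. x < y \<Longrightarrow> sortable (inp, s, t, out @ [x])"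
    if "sortable (inp, s, t', out)" for t'
    using that
  proof (induction arbitrary: t rule: sortable_induct)
    case (enter inp y s t' out)
    then show ?case by (auto intro: sortable.enter)
  next
    case (move inp y s t' out)
    from sortable_stacks(2)[OF move.hyps(1)] move.prems show ?case by fastforce
  qed auto
  with assms show ?thesis by blast
qed

lemma sortable_pops_second:
  assumes "sortable (inp, s, us @ t, out)" "sorted_wrt (<) us"
    "\<forall>u\<in>set us. \<forall>y\<in>set inp \<union> set s \<union> set t. u < y"
  shows "sortable (inp, s, t, out @ us)"
  using assms
proof (induction us arbitrary: out)
  case (Cons u us)
  then have "sortable (inp, s, us @ t, out @ [u])"
    by (intro sortable_pop_second) auto
  with Cons show ?case by fastforce
qed simp

text \<open>Nothing can be released before the minimum \<open>x\<close>. The steps up to the move of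
  \<open>x\<close> remain valid with \<open>x\<close> deleted from the bottom, and after its move it
  can be released at once.\<close>

lemma sortable_remove_bottom:
  assumes "sortable (inp, s @ [x], t, out)" "\<forall>y\<in>set inp \<union> set s \<union> set t. x < y"
  shows "sortable (inp, s, t, out @ [x])"
proof -
  have "s' = s @ [x] \<Longrightarrow> \<forall>y\<in>set inp \<union> set s \<union> set t. x < y \<Longrightarrow> sortable (inp, s, t, out @ [x])"
    if "sortable (inp, s', t, out)" for s'
    using that
  proof (induction arbitrary: s rule: sortable_induct)
    case (enter inp y s' t out)
    from enter.IH[of "y # s"] enter.prems show ?case by (auto intro: sortable.enter)
  next
    case (move inp y s' t out)
    show ?case
    proof (cases s)
      case Nil
      with move show ?thesis by (auto intro!: sortable_pop_second)
    next
      case (Cons u v)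
      with move show ?thesis by (auto intro!: sortable.move)
    qed
  next
    case (release inp y s' t out)
    from sortable_out[OF release.hyps(1)] release.prems have "y < x" by auto
    with release.prems show ?case by auto
  qed auto
  with assms show ?thesis by blast
qed

context
  fixes inp s t out m
  assumes sortable: "sortable (inp, s, t, out)"
    and dist: "distinct (inp @ s @ t)"
    and gt: "\<forall>y\<in>set inp \<union> set s \<union> set t. m < y"
    and min: "Suc m \<in> set inp"
begin

text \<open>A completion that moved the top \<open>y\<close> instead would leave \<open>y\<close> on
  the second stack with the larger \<open>x\<close> ahead of the smaller \<open>Suc m\<close> in the
  input, which \<open>not_sortable\<close> excludes.\<close>

lemma sortable_enter:
  assumes "inp = x # inp'" "\<forall>y\<in>set s. y < x" "\<forall>y\<in>set t. x < y"
  shows "sortable (inp', x # s, t, out)"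
  using sortable
proof cases
  case (enter inp'' y)
  with assms(1) show ?thesis by simp
next
  case (move s' y)
  have "y < x" "m < y" using assms(2) gt move(1) by auto
  moreover have "Suc m \<noteq> y" using dist min move(1) by auto
  ultimately have "Suc m < y" "Suc m \<in> set inp'" using assms(1) min by auto
  moreover have "\<exists>p q. inp = p @ x # q \<and> Suc m \<in> set q"
    using assms(1) calculation(2) by (intro exI[of _ "[]"] exI[of _ inp']) simp
  ultimately have False
    using not_sortable[OF move(2), of y "Suc m" x] \<open>y < x\<close> by simp
  then show ?thesis ..
next
  case (release t' y)
  \<comment> \<open>\<open>Suc m\<close> is still to be output, so a released entry would lie
    strictly between \<open>m\<close> and \<open>Suc m\<close>.\<close>
  have "y < Suc m" using sortable_out[OF release(2)] min by simp
  moreover have "m < y" using gt release(1) by simp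
  ultimately show ?thesis by simp
qed (use min in simp)

text \<open>If a completion entered \<open>x\<close> here, then some \<open>a\<close> on the second
  stack would be smaller than \<open>x\<close>; with \<open>x\<close> on the first stack and
  \<open>Suc m\<close> still in the input, \<open>not_sortable\<close> applies again.\<close>

lemma sortable_move:
  assumes "\<not> (\<exists>x inp'. inp = x # inp' \<and> (\<forall>y\<in>set s. y < x) \<and> (\<forall>y\<in>set t. x < y))"
  shows "\<exists>x s'. s = x # s' \<and> sortable (inp, s', x # t, out)"
  using sortable
proof cases
  case (enter inp' x)
  from sortable_stacks(1)[OF enter(2)] have "\<forall>y\<in>set s. y < x" by simp
  with assms enter(1) obtain a where a: "a \<in> set t" "\<not> x < a" by auto
  then have "a < x" using dist enter(1) by (cases "a = x") auto
  moreover have "Suc m \<noteq> a" using min dist a(1) by auto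
  moreover have "m < a" using gt a(1) by simp
  ultimately have "Suc m < a" by simp
  moreover have "Suc m \<in> set inp'"
    using min enter(1) \<open>Suc m < a\<close> \<open>a < x\<close> by simp
  ultimately have False using not_sortable[OF enter(2), of a "Suc m" x] a(1) \<open>a < x\<close> by simp
  then show ?thesis ..
next
  case (release t' y)
  have "y < Suc m" using sortable_out[OF release(2)] min by simp
  moreover have "m < y" using gt release(1) by simp
  ultimately show ?thesis by simp
next
  case (move s' y)
  then show ?thesis by blast
qed (use min in simp)

end

section \<open>ADI words as block words\<close>

text \<open>\<open>Block k\<close> stands for entering the smallest remaining value, moving it, and
  releasing it with the values that follow it; \<open>Up\<close> and \<open>Down\<close> are the
  other \<open>E\<close> and \<open>N\<close>.\<close>

datatype token = Up | Down | Block nat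

fun expand :: "token list \<Rightarrow> letter list" where
  "expand [] = []"
| "expand (Up # U) = E # expand U"
| "expand (Down # U) = N # expand U"
| "expand (Block k # U) = E # N # replicate k C @ expand U"

text \<open>\<open>h\<close> and \<open>c\<close> are the sizes of the two stacks; at the end both are empty.\<close>

fun good :: "nat \<Rightarrow> nat \<Rightarrow> token list \<Rightarrow> bool" where
  "good h c [] \<longleftrightarrow> h = 0 \<and> c = 0"
| "good h c (Up # U) \<longleftrightarrow> good (Suc h) c U"
| "good h c (Down # U) \<longleftrightarrow> 0 < h \<and> good (h - 1) (Suc c) U"
| "good h c (Block k # U) \<longleftrightarrow> h = 0 \<and> 0 < k \<and> k \<le> Suc c \<and> good 0 (Suc c - k) U"

text \<open>A machine state with output \<open>1, \<dots>, m\<close> from which the algorithm performs the word \<open>expand U\<close>.\<close>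

inductive codes :: "nat \<Rightarrow> nat list \<Rightarrow> nat list \<Rightarrow> nat list \<Rightarrow> token list \<Rightarrow> bool" where
  Nil: "codes m [] [] [] []"
| Up: "codes m inp (x # s) t U \<Longrightarrow> codes m (x # inp) s t (Up # U)"
| Down: "codes m inp s (x # t) U \<Longrightarrow> codes m inp (x # s) t (Down # U)"
| Block: "codes (m + Suc k) inp [] t U \<Longrightarrow>
    codes m (Suc m # inp) [] ([Suc (Suc m)..<Suc (m + Suc k)] @ t) (Block (Suc k) # U)"

lemma codes_good: "codes m inp s t U \<Longrightarrow> good (length s) (length t) U"
  by (induction rule: codes.induct) (auto simp del: upt_Suc)

text \<open>Built from the end of the word, the derivation undoes one token at a time; the counts in
  \<open>good\<close> ensure that the entry to be taken back is on its stack.\<close>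

lemma good_codes:
  assumes "good h c U"
  shows "\<exists>inp s t. codes m inp s t U \<and> length s = h \<and> length t = c"
  using assms
proof (induction U arbitrary: h c m)
  case Nil
  then show ?case by (auto intro: codes.Nil)
next
  case (Cons a U)
  show ?case
  proof (cases a)
    case Up
    with Cons.prems have "good (Suc h) c U" by simp
    from Cons.IH[OF this, of m] obtain inp s t where
      IH: "codes m inp s t U" "length s = Suc h" "length t = c" by blast
    then obtain x s' where "s = x # s'" by (cases s) auto
    with IH Up have "codes m (x # inp) s' t (a # U)" "length s' = h" by (auto intro: codes.Up)
    with IH(3) show ?thesis by blast
  next
    case Down
    with Cons.prems have "good (h - 1) (Suc c) U" "0 < h" by auto
    from Cons.IH[OF this(1), of m] obtain inp s t where
      IH: "codes m inp s t U" "length s = h - 1" "length t = Suc c" by blast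
    then obtain x t' where "t = x # t'" by (cases t) auto
    with IH Down \<open>0 < h\<close> have "codes m inp (x # s) t' (a # U)" "length (x # s) = h" "length t' = c"
      by (auto intro: codes.Down)
    then show ?thesis by blast
  next
    case (Block k)
    with Cons.prems obtain l where l: "k = Suc l" "h = 0" "l \<le> c" "good 0 (c - l) U"
      by (cases k) auto
    from Cons.IH[OF l(4), of "m + Suc l"] obtain inp s t where
      IH: "codes (m + Suc l) inp s t U" "length s = 0" "length t = c - l" by blast
    then have "codes m (Suc m # inp) [] ([Suc (Suc m)..<Suc (m + Suc l)] @ t) (a # U)"
      using codes.Block[of m l inp t U] Block l(1) by simp
    moreover have "length ([Suc (Suc m)..<Suc (m + Suc l)] @ t) = c" using IH(3) l(3) by (simp del: upt_Suc)
    ultimately show ?thesis using l(2) by blast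
  qed
qed

text \<open>Undoing a given token is deterministic. Hence a block word determines its
  permutation.\<close>

lemma codes_unique:
  "codes m inp s t U \<Longrightarrow> codes m inp' s' t' U \<Longrightarrow> length s = length s' \<Longrightarrow> length t = length t' \<Longrightarrow>
    inp = inp' \<and> s = s' \<and> t = t'"
proof (induction arbitrary: inp' s' t' rule: codes.induct)
  case (Nil m)
  then show ?case by (auto elim: codes.cases)
next
  case (Up m inp x s t U)
  from Up.prems(1) show ?case by cases (use Up.IH Up.prems in fastforce)+
next
  case (Down m inp s x t U)
  from Down.prems(1) show ?case by cases (use Down.IH Down.prems in fastforce)+
next
  case (Block m k inp t U)
  from Block.prems(1) show ?case by cases (use Block.IH Block.prems in fastforce)+
qed

fun outputs :: "token list \<Rightarrow> nat" where
  "outputs [] = 0"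
| "outputs (Block k # U) = k + outputs U"
| "outputs (_ # U) = outputs U"

text \<open>After \<open>U\<close> both stacks are empty and the output has grown by
  \<open>outputs U\<close>, so \<open>U'\<close> starts afresh. With \<open>codes_shift\<close> this
  is the direct sum on the level of words.\<close>

lemma codes_append:
  "codes m inp s t U \<Longrightarrow> codes (m + outputs U) inp' [] [] U' \<Longrightarrow> codes m (inp @ inp') s t (U @ U')"
proof (induction rule: codes.induct)
  case (Block m k inp t U)
  then have "codes (m + Suc k) (inp @ inp') [] t (U @ U')" by (simp add: add.assoc)
  from codes.Block[OF this] show ?case by (simp del: upt_Suc)
qed (auto intro: codes.intros)

lemma codes_length:
  "codes m inp s t U \<Longrightarrow> length inp + length s + length t = outputs U"
  by (induction rule: codes.induct) (auto simp del: upt_Suc)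

lemma map_add_upt_shift: "map (\<lambda>x. x + d) [i..<j] = [i + d..<j + (d :: nat)]"
  by (induction j) auto

lemma codes_shift:
  "codes m inp s t U \<Longrightarrow>
    codes (m + d) (map (\<lambda>x. x + d) inp) (map (\<lambda>x. x + d) s) (map (\<lambda>x. x + d) t) U"
proof (induction rule: codes.induct)
  case (Block m k inp t U)
  then have "codes (m + d + Suc k) (map (\<lambda>x. x + d) inp) [] (map (\<lambda>x. x + d) t) U"
    by (simp add: ac_simps)
  from codes.Block[OF this] show ?case
    by (simp del: upt_Suc add: map_add_upt_shift ac_simps)
qed (auto intro: codes.intros)

text \<open>The chain \<open>rev s @ t\<close> carries the order of both stacks at once. The bound
  on \<open>hd inp\<close> holds because the second stack only grows until that entry enters below
  it; it is what makes the algorithm choose \<open>N\<close> at a \<open>Down\<close>.\<close>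

lemma codes_invariant:
  assumes "codes m inp s t U"
  shows "distinct (inp @ s @ t) \<and> set (inp @ s @ t) = {Suc m..m + outputs U} \<and>
    sorted_wrt (<) (rev s @ t) \<and> (\<forall>y\<in>set t. hd inp < y) \<and>
    (if U = [] then inp = [] \<and> s = [] \<and> t = [] else Suc m \<in> set inp)"
  using assms
proof (induction rule: codes.induct)
  case (Up m inp x s t U)
  then show ?case by (auto simp: sorted_wrt_append split: if_splits)
next
  case (Down m inp s x t U)
  then show ?case by (auto simp: sorted_wrt_append split: if_splits)
next
  case (Block m k inp t U)
  let ?u = "[Suc (Suc m)..<Suc (m + Suc k)]"
  have t: "set inp \<union> set t = {Suc (m + Suc k)..m + Suc k + outputs U}"
    and d: "distinct inp" "distinct t" "set inp \<inter> set t = {}" "sorted_wrt (<) t"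
    using Block.IH by auto
  have gt: "Suc m + k < y" if "y \<in> set inp \<union> set t" for y
    using that unfolding t by simp
  have "set (Suc m # inp) \<union> set (?u @ t) = insert (Suc m) (set ?u \<union> (set inp \<union> set t))"
    by auto
  also have "\<dots> = {Suc m..m + (Suc k + outputs U)}"
    unfolding t by auto
  finally have "set ((Suc m # inp) @ [] @ ?u @ t) = {Suc m..m + outputs (Block (Suc k) # U)}"
    by simp
  moreover have u: "set ?u = {Suc (Suc m)..Suc m + k}" by auto
  have "distinct ((Suc m # inp) @ [] @ ?u @ t)"
    using d gt unfolding distinct_append distinct.simps set_append u by force
  moreover have "sorted_wrt (<) (?u @ t)"
    using d(4) gt unfolding sorted_wrt_append u by (force simp del: upt_Suc)
  moreover have "\<forall>y\<in>set (?u @ t). Suc m < y"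
    using gt unfolding set_append u by force
  ultimately show ?case by simp
qed (auto)

section \<open>The algorithm on coded states\<close>

lemma ADI_from_pops:
  "ADI_from (inp, s, [Suc (length out)..<Suc (length out) + k] @ t, out) =
    replicate k C @ ADI_from (inp, s, t, out @ [Suc (length out)..<Suc (length out) + k])"
proof (induction k arbitrary: out)
  case (Suc k)
  have eq: "[Suc (length out)..<Suc (length out) + Suc k] =
    Suc (length out) # [Suc (length (out @ [Suc (length out)]))..<Suc (length (out @ [Suc (length out)])) + k]"
    by (simp add: upt_conv_Cons del: upt_Suc)
  show ?case unfolding eq
    by (subst ADI_from.simps) (use Suc.IH[of "out @ [Suc (length out)]"] in \<open>simp del: upt_Suc\<close>)
qed simp

text \<open>While the minimum \<open>Suc m\<close> is in the input, steps (1) and (2) of the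
  algorithm cannot apply, and the invariant decides between entering and moving.\<close>

lemma ADI_from_codes:
  "codes m inp s t U \<Longrightarrow> length out = m \<Longrightarrow> ADI_from (inp, s, t, out) = expand U"
proof (induction arbitrary: out rule: codes.induct)
  case (Nil m)
  then show ?case by (simp add: ADI_from.simps)
next
  case (Up m inp x s t U)
  from codes_invariant[OF codes.Up[OF Up.hyps]] codes_invariant[OF Up.hyps]
  have inv: "distinct (x # inp @ s @ t)" "sorted_wrt (<) (rev (x # s) @ t)" "Suc m \<in> set inp"
    by (auto split: if_splits)
  have 1: "\<not> (t \<noteq> [] \<and> hd t = Suc (length out))" using inv Up.prems by (cases t) auto
  have 2: "\<not> (s \<noteq> [] \<and> set s = {Suc (length out)..length out + length s})"
  proof
    assume *: "s \<noteq> [] \<and> set s = {Suc (length out)..length out + length s}"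
    then have "Suc m \<in> set s" using Up.prems by (cases s) auto
    with inv show False by auto
  qed
  have 3: "(t = [] \<or> x < hd t) \<and> (s = [] \<or> hd s < x)"
    using inv(2) by (cases t; cases s) (auto simp: sorted_wrt_append)
  show ?case by (subst ADI_from.simps) (use 1 2 3 Up.IH[OF Up.prems] in auto)
next
  case (Down m inp s x t U)
  from codes_invariant[OF codes.Down[OF Down.hyps]] codes_invariant[OF Down.hyps]
  have inv: "distinct (inp @ x # s @ t)" "Suc m \<in> set inp" "hd inp < x"
    by (auto split: if_splits)
  have 1: "\<not> (t \<noteq> [] \<and> hd t = Suc (length out))" using inv Down.prems by (cases t) auto
  have 2: "set (x # s) \<noteq> {Suc (length out)..length out + length (x # s)}"
  proof
    assume "set (x # s) = {Suc (length out)..length out + length (x # s)}"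
    then have "Suc m \<in> set (x # s)" using Down.prems by auto
    with inv show False by auto
  qed
  show ?case by (subst ADI_from.simps) (use 1 2 inv(3) Down.IH[OF Down.prems] in auto)
next
  case (Block m k inp t U)
  let ?t = "[Suc (Suc m)..<Suc (m + Suc k)] @ t"
  from codes_invariant[OF codes.Block[OF Block.hyps]]
  have lt: "\<forall>y\<in>set ?t. Suc m < y" by auto
  have 1: "\<not> (?t \<noteq> [] \<and> hd ?t = Suc (length out))" 
    using lt Block.prems hd_in_set[of ?t] by fastforce
  have 2: "?t = [] \<or> Suc m < hd ?t" using lt hd_in_set[of ?t] by blast
  have 3: "Suc m # ?t = [Suc (length out)..<Suc (length out) + Suc k] @ t"
    using Block.prems by (simp add: upt_conv_Cons del: upt_Suc)
  have "ADI_from (Suc m # inp, [], ?t, out) = E # ADI_from (inp, [Suc m], ?t, out)"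
    by (subst ADI_from.simps) (use 1 2 in \<open>simp del: upt_Suc\<close>)
  \<comment> \<open>Here step (2) of the algorithm applies, with \<open>Suc m\<close> alone on the
    first stack.\<close>
  also have "ADI_from (inp, [Suc m], ?t, out) = N # ADI_from (inp, [], Suc m # ?t, out)"
    by (subst ADI_from.simps) (use 1 Block.prems in \<open>auto simp del: upt_Suc\<close>)
  also have "ADI_from (inp, [], Suc m # ?t, out) = replicate (Suc k) C @ expand U"
    unfolding 3 ADI_from_pops using Block by (simp del: upt_Suc)
  finally show ?case by simp
qed

text \<open>Each token consists of one or several \<open>sortable\<close> steps, whose order
  conditions come from \<open>codes_invariant\<close>.\<close>

lemma codes_sortable:
  "codes m inp s t U \<Longrightarrow> sortable (inp, s, t, [1..<Suc m])"
proof (induction rule: codes.induct)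
  case (Nil m)
  show ?case by (rule sortable.finish) (simp del: upt_Suc)
next
  case (Up m inp x s t U)
  from Up.IH show ?case by (rule sortable.enter)
next
  case (Down m inp s x t U)
  from codes_invariant[OF codes.Down[OF Down.hyps]] have "\<forall>y\<in>set s. y < x"
    by (simp add: sorted_wrt_append)
  with Down.IH show ?case by (rule sortable.move)
next
  case (Block m k inp t U)
  have pops: "sortable (inp, [], us @ t, out)"
    if "sortable (inp, [], t, out @ us)" "sorted_wrt (<) (us @ t)" for us out
    using that
  proof (induction us arbitrary: out)
    case (Cons u us)
    then have "sortable (inp, [], us @ t, out @ [u])" by simp
    moreover have "\<forall>y\<in>set (us @ t). u < y" using Cons.prems(2) by simp
    ultimately show ?case using sortable.release by simp
  qed simp
  let ?t = "[Suc (Suc m)..<Suc (m + Suc k)] @ t"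
  from codes_invariant[OF codes.Block[OF Block.hyps]]
  have s: "sorted_wrt (<) ?t" "\<forall>y\<in>set ?t. Suc m < y" by auto
  have "[1..<Suc (m + Suc k)] = [1..<Suc m] @ Suc m # [Suc (Suc m)..<Suc (m + Suc k)]"
    using upt_add_eq_append[of 1 "Suc m" "Suc k"] by (simp add: upt_conv_Cons del: upt_Suc)
  then have "sortable (inp, [], t, [1..<Suc m] @ Suc m # [Suc (Suc m)..<Suc (m + Suc k)])"
    using Block.IH by (simp del: upt_Suc)
  then have "sortable (inp, [], (Suc m # [Suc (Suc m)..<Suc (m + Suc k)]) @ t, [1..<Suc m])"
    by (rule pops) (use s in \<open>auto simp del: upt_Suc\<close>)
  then have "sortable (inp, [], Suc m # ?t, [1..<Suc m])" by simp
  then have "sortable (inp, [Suc m], ?t, [1..<Suc m])" by (rule sortable.move) simp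
  then show ?case by (rule sortable.enter)
qed

section \<open>From sortable states to block words\<close>

lemma consecutive_prefix:
  assumes "sorted_wrt (<) (t :: nat list)" "\<forall>y\<in>set t. a \<le> y"
  shows "\<exists>k t'. t = [a..<a + k] @ t' \<and> a + k \<notin> set t'"
  using assms
proof (induction t arbitrary: a)
  case Nil
  have "[] = [a..<a + 0] @ []" "a + 0 \<notin> set []" by simp_all
  then show ?case by blast
next
  case (Cons x t)
  show ?case
  proof (cases "x = a")
    case True
    with Cons.prems have "\<forall>y\<in>set t. Suc a \<le> y" by auto
    with Cons.IH[of "Suc a"] Cons.prems(1) obtain k t' where
      k: "t = [Suc a..<Suc a + k] @ t'" "Suc a + k \<notin> set t'" by auto
    have "x # t = [a..<a + Suc k] @ t'"
      using True k(1) by (simp add: upt_conv_Cons del: upt_Suc)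
    moreover have "a + Suc k \<notin> set t'" using k(2) by simp
    ultimately show ?thesis by blast
  next
    case False
    then have "a \<notin> set (x # t)" using Cons.prems by auto
    moreover have "x # t = [a..<a + 0] @ x # t" by simp
    ultimately show ?thesis by (metis add_0_right)
  qed
qed

text \<open>The construction follows the algorithm: enter whenever the order allows it and move
  otherwise. The exchange lemmas keep the state sortable, and entering the minimum starts a
  block.\<close>

lemma sortable_codes:
  assumes "sortable (inp, s, t, out)" "length out = m"
    and "distinct (inp @ s @ t)" "set (inp @ s @ t) = {Suc m..m + length (inp @ s @ t)}"
    and "sorted_wrt (<) (rev s @ t)"
    and "if inp = [] then s = [] \<and> t = [] else Suc m \<in> set inp"
  shows "\<exists>U. codes m inp s t U"
  using assms
\<comment> \<open>The weight 2 on the input makes entering decrease the measure, although the first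
  stack grows.\<close>
proof (induction "2 * length inp + length s" arbitrary: inp s t out m rule: less_induct)
  case less
  note sortable = less.prems(1) and m = less.prems(2) and dist = less.prems(3)
    and vals = less.prems(4) and sorted = less.prems(5)
  have gt: "\<forall>y\<in>set inp \<union> set s \<union> set t. m < y"
  proof
    fix y assume "y \<in> set inp \<union> set s \<union> set t"
    then have "y \<in> set (inp @ s @ t)" by simp
    then show "m < y" unfolding vals by simp
  qed
  show ?case
  proof (cases "inp = []")
    case True
    with less.prems(6) have "s = []" "t = []" by auto
    with True show ?thesis using codes.Nil by blast
  next
    case False
    with less.prems(6) have min: "Suc m \<in> set inp" by simp
    show ?thesis
    proof (cases "\<exists>x inp'. inp = x # inp' \<and> (\<forall>y\<in>set s. y < x) \<and> (\<forall>y\<in>set t. x < y)")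
      case True
      then obtain x inp' where x: "inp = x # inp'" "\<forall>y\<in>set s. y < x" "\<forall>y\<in>set t. x < y" by blast
      have enter: "sortable (inp', x # s, t, out)"
        by (rule sortable_enter[OF sortable dist gt min x])
      show ?thesis
      proof (cases "x = Suc m")
        case False
        have "\<exists>U. codes m inp' (x # s) t U"
        proof (rule less.hyps[OF _ enter m])
          show "set (inp' @ (x # s) @ t) = {Suc m..m + length (inp' @ (x # s) @ t)}"
            using vals unfolding x(1) by auto
          show "sorted_wrt (<) (rev (x # s) @ t)"
            using sorted x(2,3) by (auto simp: sorted_wrt_append)
          show "if inp' = [] then x # s = [] \<and> t = [] else Suc m \<in> set inp'"
            using min False x(1) by auto
        qed (use x(1) dist in auto)
        then show ?thesis using codes.Up x(1) by blast
      next
        case True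
        \<comment> \<open>Entries of \<open>s\<close> would have to lie strictly between
          \<open>m\<close> and \<open>Suc m\<close>.\<close>
        have "s = []" using x(2) gt True by (cases s) auto
        have "\<forall>y\<in>set t. Suc (Suc m) \<le> y" using x(3) True by auto
        moreover have "sorted_wrt (<) t" using sorted by (simp add: sorted_wrt_append)
        \<comment> \<open>The maximal run of consecutive values on top of the second stack is what
          is released right after \<open>Suc m\<close>; its length \<open>k\<close> fixes the
          block.\<close>
        ultimately obtain k t' where
          k: "t = [Suc (Suc m)..<Suc (Suc m) + k] @ t'" "Suc (Suc m) + k \<notin> set t'"
          using consecutive_prefix by blast
        let ?u = "[Suc (Suc m)..<Suc (Suc m) + k]"
        have u: "set ?u = {Suc (Suc m)..Suc m + k}" by auto
        have sorted': "sorted_wrt (<) t'" "\<forall>v\<in>set ?u. \<forall>y\<in>set t'. v < y"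
          using \<open>sorted_wrt (<) t\<close> unfolding k(1) sorted_wrt_append by blast+
        have rest: "set inp' \<union> set t' = {Suc (Suc m + k)..Suc m + k + length (inp' @ t')}"
        proof -
          have "length (inp @ s @ t) = Suc k + length (inp' @ t')"
            using x(1) k(1) \<open>s = []\<close> by (simp del: upt_Suc)
          then have "set (inp @ s @ t) = {Suc m..m + (Suc k + length (inp' @ t'))}"
            unfolding vals by (simp only:)
          also have "\<dots> = {Suc m..Suc m + k} \<union> {Suc (Suc m + k)..Suc m + k + length (inp' @ t')}"
            by auto
          finally have "set (inp @ s @ t) = \<dots>" .
          moreover have "set (inp @ s @ t) = {Suc m..Suc m + k} \<union> (set inp' \<union> set t')"
            unfolding x(1) k(1) \<open>s = []\<close> set_append u True by auto
          moreover have "{Suc m..Suc m + k} \<inter> (set inp' \<union> set t') = {}"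
          proof -
            have "{Suc m..Suc m + k} = insert (Suc m) (set ?u)" unfolding u by auto
            moreover have "insert (Suc m) (set ?u) \<inter> (set inp' \<union> set t') = {}"
              using dist unfolding x(1) k(1) True by auto
            ultimately show ?thesis by simp
          qed
          moreover have "{Suc m..Suc m + k} \<inter> {Suc (Suc m + k)..Suc m + k + length (inp' @ t')} = {}"
            by auto
          ultimately show ?thesis by blast
        qed
        have less_inp: "x < y" if "y \<in> set inp'" for y
        proof -
          have "m < y" "y \<noteq> x" using that gt dist unfolding x(1) by auto
          with True show ?thesis by simp
        qed
        have rest_gt: "\<forall>y\<in>set inp' \<union> set t'. Suc m + k < y" unfolding rest by simp
        from less_inp have "sortable (inp', [], t, out @ [x])"
          using sortable_remove_bottom[of inp' "[]" x t out] enter \<open>s = []\<close> x(3) by auto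
        then have "sortable (inp', [], t', (out @ [x]) @ ?u)"
          unfolding k(1)
        proof (rule sortable_pops_second)
          show "\<forall>v\<in>set ?u. \<forall>y\<in>set inp' \<union> set [] \<union> set t'. v < y"
          proof (intro ballI)
            fix v y assume "v \<in> set ?u" "y \<in> set inp' \<union> set [] \<union> set t'"
            then have "v \<le> Suc m + k" "Suc m + k < y" using rest_gt unfolding u by simp_all
            then show "v < y" by (rule le_less_trans)
          qed
        qed (rule sorted_wrt_upt)
        then have "\<exists>U. codes (m + Suc k) inp' [] t' U"
        proof (rule less.hyps[rotated])
          show "distinct (inp' @ [] @ t')"
            using dist unfolding x(1) k(1) by (simp del: upt_Suc set_upt) blast
          show "set (inp' @ [] @ t') = {Suc (m + Suc k)..m + Suc k + length (inp' @ [] @ t')}"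
            using rest by simp
          \<comment> \<open>The next minimum is not in \<open>t'\<close> because the run was
            maximal, and the first stack is empty, so it is in the input.\<close>
          show "if inp' = [] then [] = [] \<and> t' = [] else Suc (m + Suc k) \<in> set inp'"
          proof (cases "inp' = [] \<and> t' = []")
            case False
            then have "0 < length (inp' @ t')" by auto
            then have "Suc (Suc m + k) \<in> {Suc (Suc m + k)..Suc m + k + length (inp' @ t')}"
              unfolding atLeastAtMost_iff by linarith
            then have "Suc (Suc m + k) \<in> set inp' \<union> set t'" unfolding rest .
            with k(2) show ?thesis by auto
          qed simp
          show "length ((out @ [x]) @ ?u) = m + Suc k" using m by (simp del: upt_Suc)
          show "sorted_wrt (<) (rev [] @ t')" using sorted' by simp
          show "2 * length inp' + length [] < 2 * length inp + length s" using x(1) by simp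
        qed
        then obtain U where "codes (m + Suc k) inp' [] t' U" ..
        from codes.Block[OF this] have "codes m inp s t (Block (Suc k) # U)"
          using x(1) k(1) True \<open>s = []\<close> by (simp del: upt_Suc)
        then show ?thesis ..
      qed
    next
      case False
      with sortable_move[OF sortable dist gt min] obtain x s' where
        x: "s = x # s'" "sortable (inp, s', x # t, out)" by blast
      have "\<exists>U. codes m inp s' (x # t) U"
      proof (rule less.hyps[OF _ x(2) m])
        show "set (inp @ s' @ x # t) = {Suc m..m + length (inp @ s' @ x # t)}"
          using vals unfolding x(1) by auto
      qed (use x(1) dist sorted min in auto)
      then show ?thesis using codes.Down x(1) by blast
    qed
  qed
qed

section \<open>Block words and lattice paths\<close>

text \<open>\<open>h\<close> is the excess of x over y at the start of the remaining path, which
  must end on the diagonal without crossing it.\<close>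

fun height_ok :: "nat \<Rightarrow> step list \<Rightarrow> bool" where
  "height_ok h [] \<longleftrightarrow> h = 0"
| "height_ok h (East # p) \<longleftrightarrow> height_ok (Suc h) p"
| "height_ok h (North # p) \<longleftrightarrow> 0 < h \<and> height_ok (h - 1) p"
| "height_ok h (Diag # p) \<longleftrightarrow> height_ok h p"

lemma path_xy_simps [simp]:
  "path_x [] = 0" "path_y [] = 0"
  "path_x (East # p) = Suc (path_x p)" "path_y (East # p) = path_y p"
  "path_x (North # p) = path_x p" "path_y (North # p) = Suc (path_y p)"
  "path_x (Diag # p) = Suc (path_x p)" "path_y (Diag # p) = Suc (path_y p)"
  "path_x (p @ q) = path_x p + path_x q" "path_y (p @ q) = path_y p + path_y q"
  by (simp_all add: path_x_def path_y_def)

lemma all_le_Suc_iff: "(\<forall>k\<le>Suc n. P k) \<longleftrightarrow> P 0 \<and> (\<forall>k\<le>n. P (Suc k))"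
  by (metis Suc_le_mono le0 not0_implies_Suc)

lemma height_ok_iff:
  "height_ok h p \<longleftrightarrow> path_y p = path_x p + h \<and>
    (\<forall>k\<le>length p. path_y (take k p) \<le> path_x (take k p) + h)"
proof (induction h p rule: height_ok.induct)
  case (3 h p)
  show ?case
  proof (cases h)
    case (Suc h')
    with 3 show ?thesis by (simp add: all_le_Suc_iff)
  qed (auto simp: all_le_Suc_iff)
qed (auto simp: all_le_Suc_iff)

lemma is_schroder_path_iff: "is_schroder_path m p \<longleftrightarrow> path_x p = m \<and> height_ok 0 p"
  by (auto simp: is_schroder_path_def height_ok_iff)

lemma height_ok_split:
  "height_ok h (p @ q) \<Longrightarrow> path_y p = path_x p + h \<Longrightarrow> height_ok h p \<and> height_ok 0 q"
  by (induction h p rule: height_ok.induct) auto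

text \<open>The flag tells whether the \<open>N\<close> behind a rising step is one of those
  replaced by \<open>D\<close>.\<close>

definition vertical :: "bool \<Rightarrow> step" where
  "vertical b = (if b then Diag else North)"

lemma vertical_eq [simp]: "vertical b = vertical b' \<longleftrightarrow> b = b'" "vertical b \<noteq> East" "East \<noteq> vertical b"
  "vertical True = Diag" "vertical False = North"
  by (auto simp: vertical_def)

text \<open>If \<open>l\<close> entries have been output after \<open>j\<close> vertical steps, then the queue \<open>q\<close> records which of
  the vertical steps number \<open>l + 1, \<dots>, j\<close> are diagonal. A block of \<open>C\<close>'s consumes the queue up to
  and including its first diagonal step.\<close>

inductive encodes :: "nat \<Rightarrow> bool list \<Rightarrow> token list \<Rightarrow> step list \<Rightarrow> bool" where
  Nil: "encodes 0 [] [] []"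
| Up: "encodes (Suc h) q U p \<Longrightarrow> encodes h q (Up # U) (East # p)"
| Down: "encodes h (q @ [b]) U p \<Longrightarrow> encodes (Suc h) q (Down # U) (vertical b # p)"
| Block: "encodes 0 q' U p \<Longrightarrow> q @ [b] = replicate k False @ True # q' \<Longrightarrow>
    encodes 0 q (Block (Suc k) # U) (vertical b # p)"

text \<open>The queue has as many flags as the second stack has entries, so a block cannot output
  more than is there.\<close>

lemma encodes_good: "encodes h q U p \<Longrightarrow> good h (length q) U"
proof (induction rule: encodes.induct)
  case (Block q' U p q b k)
  from arg_cong[OF Block.hyps(2), of length] Block.IH show ?case by auto
qed auto

lemma encodes_outputs: "encodes h q U p \<Longrightarrow> outputs U = length q + path_y p"
proof (induction rule: encodes.induct)
  case (Down h q b U p)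
  then show ?case by (cases b) auto
next
  case (Block q' U p q b k)
  from arg_cong[OF Block.hyps(2), of length] Block.IH show ?case by (cases b) auto
qed auto

lemma replicate_False_True_eq:
  "replicate i False @ True # v = replicate j False @ True # w \<Longrightarrow> i = j \<and> v = w"
proof (induction i arbitrary: j)
  case 0
  then show ?case by (cases j) auto
next
  case (Suc i)
  then show ?case by (cases j) auto
qed

text \<open>At a rising step, \<open>h\<close> separates \<open>Down\<close> from
  \<open>Block\<close>, and the first \<open>True\<close> of the queue gives the length of the
  block.\<close>

lemma encodes_tokens_unique: "encodes h q U p \<Longrightarrow> encodes h q U' p \<Longrightarrow> U = U'"
proof (induction arbitrary: U' rule: encodes.induct)
  case Nil
  then show ?case by (auto elim: encodes.cases)
next
  case (Up h q U p)
  from Up.prems show ?case by cases (use Up.IH in auto)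
next
  case (Down h q b U p)
  from Down.prems show ?case by cases (use Down.IH in auto)
next
  case (Block q' U p q b k)
  from Block.prems show ?case
  proof cases
    case (Block q2 U2 b2 k2)
    have "replicate k False @ True # q' = replicate k2 False @ True # q2"
      using Block(2,4) \<open>q @ [b] = _\<close> by simp
    then have "k = k2" "q' = q2" using replicate_False_True_eq by blast+
    with Block Block.IH show ?thesis by simp
  qed auto
qed

text \<open>The flags are determined from the end: undoing a block prepends
  \<open>replicate k False @ [True]\<close> to the later queue, and the last flag of the result is
  the current step.\<close>

lemma encodes_path_unique:
  "encodes h q U p \<Longrightarrow> encodes h q' U p' \<Longrightarrow> length q = length q' \<Longrightarrow> q = q' \<and> p = p'"
proof (induction arbitrary: q' p' rule: encodes.induct)
  case Nil
  then show ?case by (auto elim: encodes.cases)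
next
  case (Up h q U p)
  from Up.prems(1) show ?case by cases (use Up in auto)
next
  case (Down h q b U p)
  from Down.prems(1) show ?case
  proof cases
    case (Down b2 p2)
    with Down.IH[of "q' @ [b2]" p2] Down.prems(2) show ?thesis by simp
  qed
next
  case (Block q1 U p q b k)
  from Block.prems(1) show ?case
  proof cases
    case (Block q2 p2 b2)
    have "length q1 = length q2"
      using arg_cong[OF Block(3), of length] arg_cong[OF \<open>q @ [b] = _\<close>, of length] Block.prems(2)
      by simp
    with Block.IH[of q2 p2] Block have "q1 = q2" "p = p2" by auto
    with Block(3) \<open>q @ [b] = _\<close> have "q @ [b] = q' @ [b2]" by simp
    with \<open>p = p2\<close> Block(1) show ?thesis by simp
  qed
qed

text \<open>A \<open>Down\<close> drawn as \<open>Diag\<close> lowers \<open>h\<close> but not the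
  excess of the path, and its \<open>True\<close> in the queue keeps account of this. A block
  consumes exactly one \<open>True\<close>.\<close>

lemma encodes_height:
  "encodes h q U p \<Longrightarrow> height_ok (h + count_list q True) p"
proof (induction rule: encodes.induct)
  case (Down h q b U p)
  then show ?case by (cases b) auto
next
  case (Block q' U p q b k)
  from arg_cong[OF Block.hyps(2), of "\<lambda>q. count_list q True"] 
  have "count_list q True + (if b then 1 else 0) = Suc (count_list q' True)"
    by (auto simp: count_list_0_iff)
  with Block.IH show ?case by (cases b) auto
qed auto

text \<open>The queue must be empty at the end, so the last token is a block, and the single
  \<open>True\<close> it consumes is the flag of its own step.\<close>

lemma encodes_last: "encodes h q U p \<Longrightarrow> p \<noteq> [] \<Longrightarrow> last p = Diag"
proof (induction rule: encodes.induct)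
  case (Down h q b U p)
  then show ?case by (auto elim: encodes.cases)
next
  case (Block q' U p q b k)
  show ?case
  proof (cases "p = []")
    case True
    with Block.hyps(1) have "q' = []" by (auto elim: encodes.cases)
    with Block.hyps(2) True show ?thesis by simp
  qed (use Block in auto)
qed (auto elim: encodes.cases)

text \<open>The tokens can be read off the path from left to right; the appended \<open>Diag\<close>
  closes the last block.\<close>

lemma encodes_exists:
  "height_ok (h + count_list q True) p \<Longrightarrow> \<exists>U. encodes h q U (p @ [Diag])"
proof (induction p arbitrary: h q)
  case Nil
  then have "h = 0" "q = replicate (length q) False"
    by (auto simp: count_list_0_iff intro!: replicate_eqI)
  \<comment> \<open>No \<open>True\<close> is pending, so the final block takes the whole queue
    together with its own flag.\<close>
  moreover from this(2) have "encodes 0 q [Block (Suc (length q))] [vertical True]"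
    by (intro encodes.Block[OF encodes.Nil]) auto
  ultimately show ?case by auto
next
  case (Cons a p)
  show ?case
  proof (cases "a = East")
    case True
    with Cons.prems have "height_ok (Suc h + count_list q True) p" by simp
    with Cons.IH obtain U where "encodes (Suc h) q U (p @ [Diag])" by blast
    from encodes.Up[OF this] True show ?thesis by auto
  next
    case False
    then obtain b where b: "a = vertical b" by (metis step.exhaust vertical_eq(4,5))
    show ?thesis
    proof (cases h)
      case (Suc h')
      with Cons.prems b have "height_ok (h' + count_list (q @ [b]) True) p"
        by (cases b) auto
      with Cons.IH obtain U where "encodes h' (q @ [b]) U (p @ [Diag])" by blast
      from encodes.Down[OF this] Suc b show ?thesis by auto
    next
      case 0
      \<comment> \<open>With \<open>h = 0\<close>, a \<open>North\<close> step needs positive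
        excess, which only a queued \<open>True\<close> provides; a \<open>Diag\<close> step brings
        its own.\<close>
      with Cons.prems b have "0 < count_list (q @ [b]) True"
        by (cases b) auto
      then have "True \<in> set (q @ [b])" by (metis count_notin less_irrefl)
      then obtain r q' where r: "q @ [b] = r @ True # q'" "True \<notin> set r" by (meson split_list_first)
      then have r': "r = replicate (length r) False" by (intro replicate_eqI) auto
      from arg_cong[OF r(1), of "\<lambda>q. count_list q True"] r(2) Cons.prems 0 b
      have "height_ok (0 + count_list q' True) p"
        by (cases b) auto
      with Cons.IH obtain U where "encodes 0 q' U (p @ [Diag])" by blast
      from encodes.Block[OF this, of q b "length r"] r(1) r' 0 b show ?thesis by auto
    qed
  qed
qed

lemma encodes_append:
  "encodes h q U p \<Longrightarrow> encodes 0 [] U' p' \<Longrightarrow> encodes h q (U @ U') (p @ p')"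
  by (induction rule: encodes.induct) (auto intro: encodes.intros)


section \<open>The map \<Phi> on block words\<close>

fun blocks :: "token list \<Rightarrow> nat list" where
  "blocks [] = []"
| "blocks (Block k # U) = k # blocks U"
| "blocks (_ # U) = blocks U"

text \<open>This is the word \<open>T\<close> read off the tokens.\<close>

fun skeleton :: "token list \<Rightarrow> letter list" where
  "skeleton [] = []"
| "skeleton (Up # U) = E # skeleton U"
| "skeleton (_ # U) = N # skeleton U"

lemma expand_not_C: "expand U \<noteq> C # w"
  by (cases U rule: expand.cases) auto

text \<open>Consequently an \<open>E\<close> coming from \<open>Up\<close> is never mistaken by
  \<open>collapse\<close> for the start of a block.\<close>

lemma expand_not_N_C: "expand U \<noteq> N # C # w"
  by (cases U rule: expand.cases) (auto simp: expand_not_C)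

lemma takeWhile_C_expand: "takeWhile (\<lambda>a. a = C) (replicate k C @ expand U) = replicate k C"
  using expand_not_C[of U] by (cases "expand U") (auto simp: takeWhile_append)

lemma dropWhile_C_expand: "dropWhile (\<lambda>a. a = C) (replicate k C @ expand U) = expand U"
  using expand_not_C[of U] by (cases "expand U") (auto simp: dropWhile_append)

lemma C_blocks_expand: "good h c U \<Longrightarrow> C_blocks (expand U) = blocks U"
proof (induction h c U rule: good.induct)
  case (4 h c k U)
  then obtain l where "k = Suc l" by (cases k) auto
  with 4 show ?case by (simp add: takeWhile_C_expand dropWhile_C_expand)
qed auto

lemma collapse_expand: "good h c U \<Longrightarrow> collapse (expand U) = skeleton U"
proof (induction h c U rule: good.induct)
  case (2 h c U)
  have "collapse (E # w) = E # collapse w" if "\<nexists>v. w = N # C # v" for w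
    using that by (cases "E # w" rule: collapse.cases) auto
  with 2 show ?case using expand_not_N_C by auto
next
  case (4 h c k U)
  then obtain l where "k = Suc l" by (cases k) auto
  with 4 show ?case by (simp add: dropWhile_C_expand)
qed auto

text \<open>These are the numbers \<ell>_i, the positions of the \<open>N\<close>'s that become
  diagonal.\<close>

definition marks :: "token list \<Rightarrow> nat set" where
  "marks U = {sum_list (take i (blocks U)) | i. i \<in> {1..length (blocks U)}}"

lemma marks_Block: "marks (Block k # U) = insert k ((\<lambda>x. x + k) ` marks U)"
proof -
  have "{1..Suc n} = insert 1 (Suc ` {1..n})" for n :: nat
    unfolding image_Suc_atLeastAtMost by auto
  moreover have "marks U = (\<lambda>i. sum_list (take i (blocks U))) ` {1..length (blocks U)}" for U
    by (auto simp: marks_def)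
  ultimately show ?thesis by (simp add: image_image add.commute del: image_Suc_atLeastAtMost)
qed

text \<open>Only numbers above \<open>k\<close> are tested when the counter starts at
  \<open>j + k\<close>, so the added \<open>k\<close> is never met.\<close>

lemma mark_shift: "mark (insert k ((\<lambda>x. x + k) ` L)) (j + k) w = mark L j w"
proof (induction L j w rule: mark.induct)
  case (3 L j w)
  then show ?case by auto
qed auto

text \<open>If rising steps are numbered from the first one not yet matched by an output, then
  \<open>1, ..., c\<close> are queued and \<open>Suc c\<close> comes next, so \<open>mark\<close>
  with counter \<open>c\<close> follows \<open>encodes\<close> token by token.\<close>

lemma good_encodes:
  "good h c U \<Longrightarrow>
    encodes h (map (\<lambda>i. i \<in> marks U) [1..<Suc c]) U (mark (marks U) c (skeleton U))"
proof (induction h c U rule: good.induct)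
  case (1 h c)
  then show ?case by (auto intro: encodes.Nil)
next
  case (2 h c U)
  then have "encodes (Suc h) (map (\<lambda>i. i \<in> marks U) [1..<Suc c]) U (mark (marks U) c (skeleton U))" by simp
  from encodes.Up[OF this] show ?case by (simp add: marks_def)
next
  case (3 h c U)
  then obtain h' where h: "h = Suc h'" by (cases h) auto
  with 3 have "encodes h' (map (\<lambda>i. i \<in> marks U) [1..<Suc c] @ [Suc c \<in> marks U]) U
    (mark (marks U) (Suc c) (skeleton U))" by simp
  from encodes.Down[OF this] show ?case by (simp add: marks_def h vertical_def)
next
  case (4 h c k U)
  then obtain l where l: "k = Suc l" "h = 0" "l \<le> c" by (cases k) auto
  let ?L = "marks (Block k # U)" and ?d = "Suc c - k"
  have IH: "encodes 0 (map (\<lambda>i. i \<in> marks U) [1..<Suc ?d]) U (mark (marks U) ?d (skeleton U))"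
    using 4 by auto
  \<comment> \<open>The block ends at position \<open>k\<close>: nothing before it is marked,
    \<open>k\<close> is, and the later marks are those of \<open>U\<close> shifted by
    \<open>k\<close>.\<close>
  have "[1..<Suc (Suc c)] = [1..<k] @ k # [1 + k..<Suc ?d + k]"
    using upt_add_eq_append[of 1 k "Suc (Suc c) - k"] l by (simp add: upt_conv_Cons del: upt_Suc)
  also have "[1 + k..<Suc ?d + k] = map (\<lambda>x. x + k) [1..<Suc ?d]"
    by (rule map_add_upt_shift[symmetric])
  finally have "map (\<lambda>i. i \<in> ?L) [1..<Suc (Suc c)] =
    map (\<lambda>i. i \<in> ?L) [1..<k] @ (k \<in> ?L) # map (\<lambda>i. i + k \<in> ?L) [1..<Suc ?d]"
    by (simp add: comp_def del: upt_Suc)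
  also have "map (\<lambda>i. i \<in> ?L) [1..<k] = replicate l False"
    by (intro replicate_eqI) (auto simp: marks_Block l)
  also have "map (\<lambda>i. i + k \<in> ?L) [1..<Suc ?d] = map (\<lambda>i. i \<in> marks U) [1..<Suc ?d]"
    by (auto simp: marks_Block simp del: upt_Suc)
  finally have "map (\<lambda>i. i \<in> ?L) [1..<Suc c] @ [Suc c \<in> ?L] =
    replicate l False @ True # map (\<lambda>i. i \<in> marks U) [1..<Suc ?d]"
    by (simp add: marks_Block)
  from encodes.Block[OF IH this] have
    "encodes 0 (map (\<lambda>i. i \<in> ?L) [1..<Suc c]) (Block k # U)
      (vertical (Suc c \<in> ?L) # mark (marks U) ?d (skeleton U))"
    using l by simp
  also have "mark (marks U) ?d (skeleton U) = mark ?L (Suc c) (skeleton U)"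
    using mark_shift[of k "marks U" ?d "skeleton U"] l by (simp add: marks_Block)
  finally show ?case using l by (simp add: vertical_def)
qed

section \<open>Direct sums\<close>

text \<open>Here \<open>p\<close> still has the final diagonal step that \<Phi> deletes.\<close>

definition corresponds :: "nat list \<Rightarrow> token list \<Rightarrow> step list \<Rightarrow> bool" where
  "corresponds \<pi> U p \<longleftrightarrow> codes 0 \<pi> [] [] U \<and> encodes 0 [] U p"

lemma corresponds_perm:
  assumes "corresponds \<pi> U p"
  shows "is_perm \<pi>" "DI_sortable \<pi>" "length \<pi> = path_x p"
proof -
  have U: "codes 0 \<pi> [] [] U" "encodes 0 [] U p" using assms by (auto simp: corresponds_def)
  have len: "length \<pi> = outputs U" using codes_length[OF U(1)] by simp
  show *: "is_perm \<pi>"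
    using codes_invariant[OF U(1)] by (simp add: is_perm_iff len)
  show "DI_sortable \<pi>" using codes_sortable[OF U(1)] DI_sortable_iff[OF *] by simp
  have "path_y p = path_x p" using encodes_height[OF U(2)] by (simp add: height_ok_iff)
  with encodes_outputs[OF U(2)] show "length \<pi> = path_x p" by (simp add: len)
qed

lemma corresponds_exists:
  assumes "is_perm \<pi>" "DI_sortable \<pi>"
  shows "\<exists>U p. corresponds \<pi> U p"
proof -
  have "\<exists>U. codes 0 \<pi> [] [] U"
  proof (rule sortable_codes)
    show "sortable (\<pi>, [], [], [])" using assms DI_sortable_iff by simp
    show "if \<pi> = [] then [] = [] \<and> [] = [] else Suc 0 \<in> set \<pi>"
      using assms(1) by (cases \<pi>) (simp_all add: is_perm_iff)
  qed (use assms(1) in \<open>simp_all add: is_perm_iff\<close>)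
  then obtain U where U: "codes 0 \<pi> [] [] U" ..
  from good_encodes codes_good[OF U] U show ?thesis
    unfolding corresponds_def by fastforce
qed

text \<open>The marked word also encodes \<open>U\<close> by \<open>good_encodes\<close>, so
  uniqueness identifies it with \<open>p\<close>.\<close>

lemma corresponds_schroder_path:
  assumes "corresponds \<pi> U p"
  shows "schroder_path_of \<pi> = butlast p"
proof -
  have U: "codes 0 \<pi> [] [] U" "encodes 0 [] U p" using assms by (auto simp: corresponds_def)
  have good: "good 0 0 U" using codes_good[OF U(1)] by simp
  have "encodes 0 [] U (mark (marks U) 0 (skeleton U))"
    using good_encodes[OF good] by simp
  with U(2) have "p = mark (marks U) 0 (skeleton U)" using encodes_path_unique by blast
  moreover have "ADI_word \<pi> = expand U"
    unfolding ADI_word_def initial_def using ADI_from_codes[OF U(1)] by simp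
  ultimately show ?thesis
    by (simp add: schroder_path_of_def \<Phi>_def C_blocks_expand[OF good] collapse_expand[OF good] marks_def
        Let_def)
qed

lemma corresponds_last:
  assumes "corresponds \<pi> U p" "\<pi> \<noteq> []"
  shows "p = schroder_path_of \<pi> @ [Diag]" "is_schroder_path (length \<pi> - 1) (schroder_path_of \<pi>)"
proof -
  have e: "encodes 0 [] U p" using assms by (auto simp: corresponds_def)
  have len: "length \<pi> = path_x p" by (rule corresponds_perm(3)[OF assms(1)])
  with assms(2) have "p \<noteq> []" by auto
  with encodes_last[OF e] have "p = butlast p @ [Diag]" by (metis append_butlast_last_id)
  then show p: "p = schroder_path_of \<pi> @ [Diag]"
    using corresponds_schroder_path[OF assms(1)] by simp
  have "height_ok 0 (schroder_path_of \<pi> @ [Diag])" using encodes_height[OF e] p by simp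
  moreover from this have "path_y (schroder_path_of \<pi>) = path_x (schroder_path_of \<pi>) + 0"
    by (simp add: height_ok_iff)
  ultimately have "height_ok 0 (schroder_path_of \<pi>)" using height_ok_split by blast
  moreover have "length \<pi> = Suc (path_x (schroder_path_of \<pi>))"
    using len by (subst (asm) p) simp
  ultimately show "is_schroder_path (length \<pi> - 1) (schroder_path_of \<pi>)"
    by (simp add: is_schroder_path_iff)
qed

text \<open>The closing \<open>Diag\<close> of \<open>p\<close> is kept inside \<open>p @ q\<close>
  and becomes the diagonal step between the two paths.\<close>

lemma corresponds_plus_sum:
  assumes "corresponds \<omega> U p" "corresponds \<tau> V q"
  shows "corresponds (\<omega> \<oplus>\<^sub>p \<tau>) (U @ V) (p @ q)"
proof -
  have c: "codes 0 \<omega> [] [] U" "codes 0 \<tau> [] [] V" "encodes 0 [] U p" "encodes 0 [] V q"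
    using assms by (auto simp: corresponds_def)
  have "outputs U = length \<omega>" using codes_length[OF c(1)] by simp
  then have "codes (0 + outputs U) (map (\<lambda>x. x + length \<omega>) \<tau>) [] [] V"
    using codes_shift[OF c(2), of "length \<omega>"] by simp
  from codes_append[OF c(1) this] encodes_append[OF c(3,4)] show ?thesis
    by (simp add: corresponds_def plus_sum_def)
qed

lemma corresponds_of_path:
  assumes "height_ok 0 p"
  shows "\<exists>\<pi> U. corresponds \<pi> U (p @ [Diag])"
proof -
  obtain U where U: "encodes 0 [] U (p @ [Diag])"
    using encodes_exists[of 0 "[]" p] assms by auto
  then have "good 0 0 U" using encodes_good by fastforce
  from good_codes[OF this, of 0] U show ?thesis by (auto simp: corresponds_def)
qed

lemma corresponds_unique:
  assumes "corresponds \<pi> U p" "corresponds \<pi>' U' p"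
  shows "\<pi> = \<pi>'"
proof -
  have "U = U'" using assms encodes_tokens_unique by (auto simp: corresponds_def)
  with assms show ?thesis using codes_unique by (auto simp: corresponds_def)
qed

section \<open>Bijectivity of the correspondence\<close>

lemma schroder_path_of_inj:
  assumes "is_perm \<pi>" "DI_sortable \<pi>" "is_perm \<pi>'" "DI_sortable \<pi>'" "\<pi> \<noteq> []" "\<pi>' \<noteq> []"
    and "schroder_path_of \<pi> = schroder_path_of \<pi>'"
  shows "\<pi> = \<pi>'"
  using assms corresponds_exists corresponds_last(1) corresponds_unique by metis

lemma schroder_path_of_plus_sum:
  assumes "is_perm \<omega>" "is_perm \<tau>" "\<omega> \<noteq> []" "\<tau> \<noteq> []" "DI_sortable \<omega>" "DI_sortable \<tau>"
  shows "schroder_path_of (\<omega> \<oplus>\<^sub>p \<tau>) = schroder_path_of \<omega> @ [Diag] @ schroder_path_of \<tau>"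
    "is_perm (\<omega> \<oplus>\<^sub>p \<tau>)" "DI_sortable (\<omega> \<oplus>\<^sub>p \<tau>)"
proof -
  obtain U p V q where c: "corresponds \<omega> U p" "corresponds \<tau> V q"
    using assms corresponds_exists by blast
  note sum = corresponds_plus_sum[OF c]
  have "p = schroder_path_of \<omega> @ [Diag]" "q = schroder_path_of \<tau> @ [Diag]"
    using c assms corresponds_last(1) by blast+
  with corresponds_schroder_path[OF sum]
  show "schroder_path_of (\<omega> \<oplus>\<^sub>p \<tau>) = schroder_path_of \<omega> @ [Diag] @ schroder_path_of \<tau>"
    by (simp add: butlast_append)
  show "is_perm (\<omega> \<oplus>\<^sub>p \<tau>)" "DI_sortable (\<omega> \<oplus>\<^sub>p \<tau>)" using corresponds_perm[OF sum] by auto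
qed

lemma schroder_path_of_correct:
  assumes "is_perm \<pi>" "DI_sortable \<pi>" "\<pi> \<noteq> []"
  shows "is_schroder_path (length \<pi> - 1) (schroder_path_of \<pi>)"
  using assms corresponds_exists corresponds_last(2) by blast

lemma schroder_path_of_surj:
  assumes "is_schroder_path m p"
  shows "\<exists>\<pi>. is_perm \<pi> \<and> DI_sortable \<pi> \<and> length \<pi> = Suc m \<and> schroder_path_of \<pi> = p"
proof -
  have "height_ok 0 p" "path_x p = m" using assms by (auto simp: is_schroder_path_iff)
  with corresponds_of_path obtain \<pi> U where "corresponds \<pi> U (p @ [Diag])" by blast
  with corresponds_perm[OF this] corresponds_schroder_path[OF this] \<open>path_x p = m\<close> show ?thesis
    by auto
qed

section \<open>Plus-decomposable permutations and main-diagonal steps\<close>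

lemma DI_sortable_plus_sumD:
  assumes "is_perm \<omega>" "is_perm \<tau>" "is_perm (\<omega> \<oplus>\<^sub>p \<tau>)" "DI_sortable (\<omega> \<oplus>\<^sub>p \<tau>)"
  shows "DI_sortable \<omega>" "DI_sortable \<tau>"
  using assms sortable_plus_sum by (auto simp: DI_sortable_iff)

lemma is_perm_plus_sum: "is_perm \<omega> \<Longrightarrow> is_perm \<tau> \<Longrightarrow> is_perm (\<omega> \<oplus>\<^sub>p \<tau>)"
proof -
  assume *: "is_perm \<omega>" "is_perm \<tau>"
  have "(\<lambda>x. x + length \<omega>) ` {1..length \<tau>} = {Suc (length \<omega>)..length \<omega> + length \<tau>}"
    by (simp add: add.commute)
  then show "is_perm (\<omega> \<oplus>\<^sub>p \<tau>)"
    using * by (auto simp: is_perm_iff plus_sum_def distinct_map inj_on_def)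
qed

text \<open>The values of the lower segment are closed downwards, hence are exactly
  \<open>1, ..., length \<omega>\<close>, and subtracting \<open>length \<omega>\<close> turns the
  upper segment into a permutation.\<close>

lemma plus_decomposable_iff:
  assumes "is_perm \<pi>"
  shows "plus_decomposable \<pi> \<longleftrightarrow>
    (\<exists>\<omega> \<tau>. is_perm \<omega> \<and> is_perm \<tau> \<and> \<omega> \<noteq> [] \<and> \<tau> \<noteq> [] \<and> \<pi> = \<omega> \<oplus>\<^sub>p \<tau>)" (is "_ \<longleftrightarrow> ?R")
proof
  assume ?R
  then obtain \<omega> \<tau> where w: "is_perm \<omega>" "is_perm \<tau>" "\<omega> \<noteq> []" "\<tau> \<noteq> []" "\<pi> = \<omega> \<oplus>\<^sub>p \<tau>" by blast
  have "\<forall>a\<in>set \<omega>. \<forall>b\<in>set (map (\<lambda>x. x + length \<omega>) \<tau>). a < b"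
  proof (intro ballI)
    fix a b assume "a \<in> set \<omega>" "b \<in> set (map (\<lambda>x. x + length \<omega>) \<tau>)"
    with w(1,2) have "a \<le> length \<omega>" "length \<omega> < b" by (auto simp: is_perm_iff)
    then show "a < b" by simp
  qed
  with w show "plus_decomposable \<pi>" unfolding plus_decomposable_def plus_sum_def by blast
next
  assume "plus_decomposable \<pi>"
  then obtain \<omega> \<tau>' where w: "\<omega> \<noteq> []" "\<tau>' \<noteq> []" "\<pi> = \<omega> @ \<tau>'" "\<forall>a\<in>set \<omega>. \<forall>b\<in>set \<tau>'. a < b"
    by (auto simp: plus_decomposable_def)
  let ?n = "length \<omega>"
  have d: "distinct \<omega>" "distinct \<tau>'" "set \<omega> \<inter> set \<tau>' = {}"
    and s: "set \<omega> \<union> set \<tau>' = {1..?n + length \<tau>'}"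
    using assms w(3) by (auto simp: is_perm_iff)
  have below: "{1..a} \<subseteq> set \<omega>" if "a \<in> set \<omega>" for a
  proof
    fix b assume b: "b \<in> {1..a}"
    have "a \<in> {1..?n + length \<tau>'}" using that s by blast
    with b have "b \<in> {1..?n + length \<tau>'}" by simp
    then have "b \<in> set \<omega> \<union> set \<tau>'" unfolding s .
    moreover have "b \<notin> set \<tau>'" using w(4) that b by force
    ultimately show "b \<in> set \<omega>" by blast
  qed
  have "set \<omega> \<subseteq> {1..?n}"
  proof
    fix a assume a: "a \<in> set \<omega>"
    have "a \<le> ?n" using card_mono[OF _ below[OF a]] distinct_card[OF d(1)] by simp
    moreover have "a \<in> {1..?n + length \<tau>'}" using a s by blast
    ultimately show "a \<in> {1..?n}" by simp
  qed
  then have w_set: "set \<omega> = {1..?n}"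
    by (intro card_subset_eq) (simp_all add: distinct_card[OF d(1)])
  have "set \<tau>' = {1..?n + length \<tau>'} - {1..?n}" using s d(3) w_set by blast
  also have "\<dots> = {Suc ?n..?n + length \<tau>'}" by auto
  finally have t_set: "set \<tau>' = {Suc ?n..?n + length \<tau>'}" .
  define \<tau> where "\<tau> = map (\<lambda>x. x - ?n) \<tau>'"
  have t': "map (\<lambda>x. x + ?n) \<tau> = \<tau>'"
    unfolding \<tau>_def map_map by (rule map_idI) (simp add: t_set)
  have "set \<tau> = {1..length \<tau>}"
  proof -
    have "set \<tau> = (\<lambda>x. x - ?n) ` {Suc ?n..?n + length \<tau>'}" by (simp add: \<tau>_def t_set)
    also have "{Suc ?n..?n + length \<tau>'} = (\<lambda>x. x + ?n) ` {1..length \<tau>'}" by (simp add: add.commute)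
    finally show ?thesis by (simp only: image_image) (simp add: \<tau>_def)
  qed
  moreover have "distinct \<tau>" using d(2) unfolding t'[symmetric] by (simp add: distinct_map)
  ultimately have "is_perm \<tau>" by (simp add: is_perm_iff)
  moreover have "is_perm \<omega>" using d(1) w_set by (simp add: is_perm_iff)
  moreover have "\<tau> \<noteq> []" using w(2) by (simp add: \<tau>_def)
  moreover have "\<pi> = \<omega> \<oplus>\<^sub>p \<tau>" using w(3) t' by (simp add: plus_sum_def)
  ultimately show ?R using w(1) by blast
qed

lemma plus_sum_path:
  assumes "is_perm \<omega>" "is_perm \<tau>" "\<omega> \<noteq> []" "\<tau> \<noteq> []" "DI_sortable (\<omega> \<oplus>\<^sub>p \<tau>)"
  shows "DI_sortable \<omega>" "DI_sortable \<tau>"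
    "schroder_path_of (\<omega> \<oplus>\<^sub>p \<tau>) = schroder_path_of \<omega> @ [Diag] @ schroder_path_of \<tau>"
    "path_x (schroder_path_of \<omega>) = path_y (schroder_path_of \<omega>)"
proof -
  show *: "DI_sortable \<omega>" "DI_sortable \<tau>"
    using DI_sortable_plus_sumD[OF assms(1,2) is_perm_plus_sum[OF assms(1,2)] assms(5)] by auto
  show "schroder_path_of (\<omega> \<oplus>\<^sub>p \<tau>) = schroder_path_of \<omega> @ [Diag] @ schroder_path_of \<tau>"
    by (rule schroder_path_of_plus_sum(1)[OF assms(1-4) *])
  show "path_x (schroder_path_of \<omega>) = path_y (schroder_path_of \<omega>)"
    using schroder_path_of_correct[OF assms(1) *(1) assms(3)] by (simp add: is_schroder_path_def)
qed

lemma has_main_diagonal_step_iff: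
  assumes "is_perm \<pi>" "\<pi> \<noteq> []" "DI_sortable \<pi>"
  shows "has_main_diagonal_step (schroder_path_of \<pi>) \<longleftrightarrow> plus_decomposable \<pi>"
proof
  assume "plus_decomposable \<pi>"
  then obtain \<omega> \<tau> where w: "is_perm \<omega>" "is_perm \<tau>" "\<omega> \<noteq> []" "\<tau> \<noteq> []" "\<pi> = \<omega> \<oplus>\<^sub>p \<tau>"
    using plus_decomposable_iff[OF assms(1)] by blast
  with plus_sum_path[of \<omega> \<tau>] assms(3) show "has_main_diagonal_step (schroder_path_of \<pi>)"
    unfolding has_main_diagonal_step_def by auto
next
  assume "has_main_diagonal_step (schroder_path_of \<pi>)"
  then obtain q r where p: "schroder_path_of \<pi> = q @ Diag # r" "path_x q = path_y q"
    by (auto simp: has_main_diagonal_step_def)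
  have "height_ok 0 (q @ Diag # r)"
    using schroder_path_of_correct[OF assms(1,3,2)] p(1) by (simp add: is_schroder_path_iff)
  from height_ok_split[OF this] p(2)
  have "is_schroder_path (path_x q) q" "is_schroder_path (path_x r) r"
    by (auto simp: is_schroder_path_iff)
  \<comment> \<open>Both halves are Schroder paths in their own right, so each comes from a sortable
    permutation with one more entry than its width.\<close>
  from this[THEN schroder_path_of_surj] obtain \<omega> \<tau> where
    w: "is_perm \<omega>" "DI_sortable \<omega>" "length \<omega> = Suc (path_x q)" "schroder_path_of \<omega> = q" and
    t: "is_perm \<tau>" "DI_sortable \<tau>" "length \<tau> = Suc (path_x r)" "schroder_path_of \<tau> = r" by blast
  then have ne: "\<omega> \<noteq> []" "\<tau> \<noteq> []" by auto
  note sum = schroder_path_of_plus_sum[OF w(1) t(1) ne w(2) t(2)]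
  have "\<pi> = \<omega> \<oplus>\<^sub>p \<tau>"
    using schroder_path_of_inj[OF assms(1,3) sum(2,3) assms(2)] sum(1) ne p(1) w(4) t(4)
    by (simp add: plus_sum_def)
  with w(1) t(1) ne show "plus_decomposable \<pi>" using plus_decomposable_iff[OF assms(1)] by blast
qed

theorem theorem4p11:
  shows "(\<forall>\<pi> \<omega> \<tau>. is_perm \<omega> \<and> is_perm \<tau> \<and> \<omega> \<noteq> [] \<and> \<tau> \<noteq> [] \<and> \<pi> = \<omega> \<oplus>\<^sub>p \<tau> \<and> DI_sortable \<pi> \<longrightarrow>
            DI_sortable \<omega> \<and> DI_sortable \<tau> \<and>
            schroder_path_of \<pi> = schroder_path_of \<omega> @ [Diag] @ schroder_path_of \<tau> \<and>
            path_x (schroder_path_of \<omega>) = path_y (schroder_path_of \<omega>))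
       \<and> (\<forall>\<pi>. is_perm \<pi> \<and> \<pi> \<noteq> [] \<and> DI_sortable \<pi> \<longrightarrow>
            (has_main_diagonal_step (schroder_path_of \<pi>) \<longleftrightarrow> plus_decomposable \<pi>))
       \<and> (\<forall>n\<ge>1. bij_betw schroder_path_of
            {\<pi> \<in> permutations_of_set {1..n}. DI_sortable \<pi> \<and> plus_decomposable \<pi>}
            {p. is_schroder_path (n - 1) p \<and> has_main_diagonal_step p})"
proof (intro conjI)
  show "\<forall>\<pi> \<omega> \<tau>. is_perm \<omega> \<and> is_perm \<tau> \<and> \<omega> \<noteq> [] \<and> \<tau> \<noteq> [] \<and> \<pi> = \<omega> \<oplus>\<^sub>p \<tau> \<and> DI_sortable \<pi> \<longrightarrow>
      DI_sortable \<omega> \<and> DI_sortable \<tau> \<and>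
      schroder_path_of \<pi> = schroder_path_of \<omega> @ [Diag] @ schroder_path_of \<tau> \<and>
      path_x (schroder_path_of \<omega>) = path_y (schroder_path_of \<omega>)"
    using plus_sum_path by blast
  show "\<forall>\<pi>. is_perm \<pi> \<and> \<pi> \<noteq> [] \<and> DI_sortable \<pi> \<longrightarrow>
      (has_main_diagonal_step (schroder_path_of \<pi>) \<longleftrightarrow> plus_decomposable \<pi>)"
    using has_main_diagonal_step_iff by blast
  show "\<forall>n\<ge>1. bij_betw schroder_path_of
      {\<pi> \<in> permutations_of_set {1..n}. DI_sortable \<pi> \<and> plus_decomposable \<pi>}
      {p. is_schroder_path (n - 1) p \<and> has_main_diagonal_step p}"
  proof (intro allI impI)
    fix n :: nat assume n: "n \<ge> 1"
    have perm: "\<pi> \<in> permutations_of_set {1..n} \<longleftrightarrow> is_perm \<pi> \<and> length \<pi> = n" for \<pi>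
      using length_finite_permutations_of_set[of \<pi> "{1..n}"] by (auto simp: is_perm_def)
    have ne: "is_perm \<pi> \<and> length \<pi> = n \<Longrightarrow> \<pi> \<noteq> []" for \<pi>
      using n by auto
    show "bij_betw schroder_path_of
      {\<pi> \<in> permutations_of_set {1..n}. DI_sortable \<pi> \<and> plus_decomposable \<pi>}
      {p. is_schroder_path (n - 1) p \<and> has_main_diagonal_step p}"
    proof (rule bij_betwI')
      fix \<pi> assume "\<pi> \<in> {\<pi> \<in> permutations_of_set {1..n}. DI_sortable \<pi> \<and> plus_decomposable \<pi>}"
      then have \<pi>: "is_perm \<pi>" "length \<pi> = n" "DI_sortable \<pi>" "plus_decomposable \<pi>" "\<pi> \<noteq> []"
        using perm ne by auto
      with schroder_path_of_correct[of \<pi>] has_main_diagonal_step_iff[of \<pi>]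
      show "schroder_path_of \<pi> \<in> {p. is_schroder_path (n - 1) p \<and> has_main_diagonal_step p}" by simp
      fix \<pi>' assume "\<pi>' \<in> {\<pi> \<in> permutations_of_set {1..n}. DI_sortable \<pi> \<and> plus_decomposable \<pi>}"
      then have "is_perm \<pi>'" "DI_sortable \<pi>'" "\<pi>' \<noteq> []" using perm ne by auto
      with \<pi> show "schroder_path_of \<pi> = schroder_path_of \<pi>' \<longleftrightarrow> \<pi> = \<pi>'"
        using schroder_path_of_inj by blast
    next
      fix p assume p: "p \<in> {p. is_schroder_path (n - 1) p \<and> has_main_diagonal_step p}"
      \<comment> \<open>\<open>n \<ge> 1\<close> gives \<open>Suc (n - 1) = n\<close>, so the
        preimage has the right length.\<close>
      then obtain \<pi> where \<pi>: "is_perm \<pi>" "DI_sortable \<pi>" "length \<pi> = n" "schroder_path_of \<pi> = p"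
        using schroder_path_of_surj[of "n - 1" p] n by auto
      then have "\<pi> \<noteq> []" using ne by blast
      then have "plus_decomposable \<pi>" using has_main_diagonal_step_iff[of \<pi>] \<pi> p by simp
      with \<pi> perm show "\<exists>\<pi>\<in>{\<pi> \<in> permutations_of_set {1..n}. DI_sortable \<pi> \<and> plus_decomposable \<pi>}.
          p = schroder_path_of \<pi>" by blast
    qed
  qed
qed

end
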